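(* For every arithmetical simulation $\alpha$ of $A^\ast$, the set $\{\alpha(\phi)\mid\phi\text{ is an }\mathcal{L}\text{-sentence and }\mathbb{N}\models\phi\}$ is not arithmetical.
   Context: Language: $\mathcal{L}$ is the first-order arithmetical language with symbols $\mathsf{0},\mathsf{S},+,\times,=,\neg,\wedge,\forall$; $\mathbb{N}$ also denotes its standard interpretation. The finite alphabet $A$ consists of these symbols together with $\mathsf{v}$, $\prime$, $($ and $)$. $A^\ast$ is the set of nonempty finite strings over $A$, with concatenation $\ast$. Variables are $\mathsf{v}$ followed by finitely many strokes; terms and formulae are the usual well-formed (fully parenthesised, infix) strings in $A^\ast$. A numbering of $A^\ast$ is an injective function $\alpha\colon A^\ast\to\mathbb{N}$. Let $G=\alpha(A^\ast)$ and let $\circledast_\alpha\colon G\times G\to G$ be $\circledast_\alpha(m,n)=\alpha(\alpha^{-1}(m)\ast\alpha^{-1}(n))$. A subset of $\mathbb{N}^k$ is arithmetical if it is definable in $\mathbb{N}$ by an $\mathcal{L}$-formula. $\alpha$ is an arithmetical simulation of $A^\ast$ if both $G$ and the graph of $\circledast_\alpha$ are arithmetical. *)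

theory Defs
  imports Main
begin

datatype symbol =
    SZero | SSucc | SPlus | STimes | SEq | SNot | SAnd | SAll
  | SVar | SStroke | SLparen | SRparen

definition Astar :: "symbol list set" where
  "Astar = {w. w \<noteq> []}"

text \<open>
  Terms and formulae are given by their parse trees; the elements of \<open>A\<^sup>*\<close> that the theorem
  speaks about are the strings \<open>term_string t\<close> and \<open>fm_string \<phi>\<close>. Unique readability
  (\<open>inj_term_string\<close>, \<open>inj_fm_string\<close> below) makes free variables and truth well-defined on
  these strings. \<open>Var i\<close> is the letter v followed by \<open>i\<close> strokes, \<open>i = 0\<close> included.
  Every binary symbol, equality included, comes with a pair of parentheses;
  the unary \<open>S\<close>, negation and quantifier prefixes carry none of their own.
\<close>

datatype trm = Var nat | Zero | Succ trm | Plus trm trm | Times trm trm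

datatype fm = Eq trm trm | Neg fm | Conj fm fm | Forall nat fm

definition var_string :: "nat \<Rightarrow> symbol list" where
  "var_string i = SVar # replicate i SStroke"

primrec term_string :: "trm \<Rightarrow> symbol list" where
  "term_string (Var i) = var_string i"
| "term_string Zero = [SZero]"
| "term_string (Succ t) = SSucc # term_string t"
| "term_string (Plus s t) = [SLparen] @ term_string s @ [SPlus] @ term_string t @ [SRparen]"
| "term_string (Times s t) = [SLparen] @ term_string s @ [STimes] @ term_string t @ [SRparen]"

primrec fm_string :: "fm \<Rightarrow> symbol list" where
  "fm_string (Eq s t) = [SLparen] @ term_string s @ [SEq] @ term_string t @ [SRparen]"
| "fm_string (Neg \<phi>) = SNot # fm_string \<phi>"
| "fm_string (Conj \<phi> \<psi>) = [SLparen] @ fm_string \<phi> @ [SAnd] @ fm_string \<psi> @ [SRparen]"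
| "fm_string (Forall i \<phi>) = SAll # var_string i @ fm_string \<phi>"

primrec tvars :: "trm \<Rightarrow> nat set" where
  "tvars (Var i) = {i}"
| "tvars Zero = {}"
| "tvars (Succ t) = tvars t"
| "tvars (Plus s t) = tvars s \<union> tvars t"
| "tvars (Times s t) = tvars s \<union> tvars t"

primrec fvars :: "fm \<Rightarrow> nat set" where
  "fvars (Eq s t) = tvars s \<union> tvars t"
| "fvars (Neg \<phi>) = fvars \<phi>"
| "fvars (Conj \<phi> \<psi>) = fvars \<phi> \<union> fvars \<psi>"
| "fvars (Forall i \<phi>) = fvars \<phi> - {i}"

primrec tval :: "(nat \<Rightarrow> nat) \<Rightarrow> trm \<Rightarrow> nat" where
  "tval e (Var i) = e i"
| "tval e Zero = 0"
| "tval e (Succ t) = Suc (tval e t)"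
| "tval e (Plus s t) = tval e s + tval e t"
| "tval e (Times s t) = tval e s * tval e t"

primrec sat :: "(nat \<Rightarrow> nat) \<Rightarrow> fm \<Rightarrow> bool" where
  "sat e (Eq s t) \<longleftrightarrow> tval e s = tval e t"
| "sat e (Neg \<phi>) \<longleftrightarrow> \<not> sat e \<phi>"
| "sat e (Conj \<phi> \<psi>) \<longleftrightarrow> sat e \<phi> \<and> sat e \<psi>"
| "sat e (Forall i \<phi>) \<longleftrightarrow> (\<forall>n. sat (e(i := n)) \<phi>)"

definition sentence :: "fm \<Rightarrow> bool" where
  "sentence \<phi> \<longleftrightarrow> fvars \<phi> = {}"

definition true_in_N :: "fm \<Rightarrow> bool" where
  "true_in_N \<phi> \<longleftrightarrow> (\<forall>e. sat e \<phi>)"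

text \<open>
  A subset of \<open>\<nat>\<^sup>k\<close> is represented by a set of lists of length \<open>k\<close>; the defining formula has
  its free variables among \<open>Var 0, \<dots>, Var (k - 1)\<close>, which denote the \<open>k\<close> coordinates in order.
\<close>

definition arithmetical :: "nat \<Rightarrow> nat list set \<Rightarrow> bool" where
  "arithmetical k R \<longleftrightarrow> R \<subseteq> {xs. length xs = k} \<and>
     (\<exists>\<phi>. fvars \<phi> \<subseteq> {..<k} \<and> (\<forall>e. map e [0..<k] \<in> R \<longleftrightarrow> sat e \<phi>))"

text \<open>A numbering is a total function on lists here; its value at \<open>[]\<close> is irrelevant.\<close>

definition numbering :: "(symbol list \<Rightarrow> nat) \<Rightarrow> bool" where
  "numbering \<alpha> \<longleftrightarrow> inj_on \<alpha> Astar"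

definition code_set :: "(symbol list \<Rightarrow> nat) \<Rightarrow> nat set" where
  "code_set \<alpha> = \<alpha> ` Astar"

definition code_concat :: "(symbol list \<Rightarrow> nat) \<Rightarrow> nat \<Rightarrow> nat \<Rightarrow> nat" where
  "code_concat \<alpha> m n = \<alpha> (inv_into Astar \<alpha> m @ inv_into Astar \<alpha> n)"

definition arithmetical_simulation :: "(symbol list \<Rightarrow> nat) \<Rightarrow> bool" where
  "arithmetical_simulation \<alpha> \<longleftrightarrow> numbering \<alpha> \<and>
     arithmetical 1 {[n] | n. n \<in> code_set \<alpha>} \<and>
     arithmetical 3 {[m, n, code_concat \<alpha> m n] | m n. m \<in> code_set \<alpha> \<and> n \<in> code_set \<alpha>}"

definition no_stroke :: "symbol list \<Rightarrow> bool" where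
  "no_stroke xs \<longleftrightarrow> (\<forall>ys. xs \<noteq> SStroke # ys)"

lemma no_stroke_simps [simp]:
  "no_stroke []" "no_stroke (c # xs) \<longleftrightarrow> c \<noteq> SStroke"
  by (auto simp: no_stroke_def)

lemma replicate_stroke_cancel:
  "replicate i SStroke @ xs = replicate j SStroke @ ys \<Longrightarrow> no_stroke xs \<Longrightarrow> no_stroke ys
    \<Longrightarrow> i = j \<and> xs = ys"
proof (induction i arbitrary: j)
  case 0
  then show ?case by (cases j) auto
next
  case (Suc i)
  then show ?case by (cases j) auto
qed

lemma term_string_cancel:
  "term_string s @ xs = term_string t @ ys \<Longrightarrow> no_stroke xs \<Longrightarrow> no_stroke ys
    \<Longrightarrow> s = t \<and> xs = ys"
proof (induction s arbitrary: t xs ys)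
  case (Var i)
  then show ?case by (cases t) (auto simp: var_string_def dest: replicate_stroke_cancel)
next
  case Zero
  then show ?case by (cases t) (auto simp: var_string_def)
next
  case (Succ s)
  then show ?case by (cases t) (auto simp: var_string_def)
next
  case (Plus s1 s2)
  from Plus.prems obtain t1 t2 where t: "t = Plus t1 t2"
    and eq: "term_string s1 @ SPlus # term_string s2 @ SRparen # xs =
             term_string t1 @ SPlus # term_string t2 @ SRparen # ys"
    by (cases t) (auto simp: var_string_def dest: Plus.IH(1))
  from Plus.IH(1)[OF eq] have "s1 = t1"
    and "term_string s2 @ SRparen # xs = term_string t2 @ SRparen # ys" by simp_all
  with Plus.IH(2)[of "SRparen # xs" t2 "SRparen # ys"] t show ?case by simp
next
  case (Times s1 s2)
  from Times.prems obtain t1 t2 where t: "t = Times t1 t2"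
    and eq: "term_string s1 @ STimes # term_string s2 @ SRparen # xs =
             term_string t1 @ STimes # term_string t2 @ SRparen # ys"
    by (cases t) (auto simp: var_string_def dest: Times.IH(1))
  from Times.IH(1)[OF eq] have "s1 = t1"
    and "term_string s2 @ SRparen # xs = term_string t2 @ SRparen # ys" by simp_all
  with Times.IH(2)[of "SRparen # xs" t2 "SRparen # ys"] t show ?case by simp
qed

lemma no_stroke_fm_string [simp]: "no_stroke (fm_string \<phi> @ xs)"
  by (cases \<phi>) auto

lemma term_string_not_fm_string: "term_string t @ xs \<noteq> fm_string \<phi> @ ys"
proof (induction \<phi> arbitrary: t xs ys)
  case (Eq s1 s2)
  then show ?case by (cases t) (auto simp: var_string_def dest!: term_string_cancel)
next
  case (Neg \<phi>)
  then show ?case by (cases t) (auto simp: var_string_def)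
next
  case (Conj \<phi> \<psi>)
  then show ?case by (cases t) (auto simp: var_string_def)
next
  case (Forall i \<phi>)
  then show ?case by (cases t) (auto simp: var_string_def)
qed

lemma fm_string_cancel:
  "fm_string \<phi> @ xs = fm_string \<psi> @ ys \<Longrightarrow> \<phi> = \<psi> \<and> xs = ys"
proof (induction \<phi> arbitrary: \<psi> xs ys)
  case (Eq s1 s2)
  then show ?case
    by (cases \<psi>) (auto simp: term_string_not_fm_string dest!: term_string_cancel)
next
  case (Neg \<phi>)
  then show ?case by (cases \<psi>) auto
next
  case (Conj \<phi>1 \<phi>2)
  from Conj.prems obtain \<psi>1 \<psi>2 where \<psi>: "\<psi> = Conj \<psi>1 \<psi>2"
    and eq: "fm_string \<phi>1 @ SAnd # fm_string \<phi>2 @ SRparen # xs =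
             fm_string \<psi>1 @ SAnd # fm_string \<psi>2 @ SRparen # ys"
    by (cases \<psi>) (auto simp: term_string_not_fm_string[symmetric])
  from Conj.IH(1)[OF eq] have "\<phi>1 = \<psi>1"
    and "fm_string \<phi>2 @ SRparen # xs = fm_string \<psi>2 @ SRparen # ys" by simp_all
  with Conj.IH(2)[of "SRparen # xs" \<psi>2 "SRparen # ys"] \<psi> show ?case by simp
next
  case (Forall i \<phi>)
  from Forall.prems obtain j \<psi>' where \<psi>: "\<psi> = Forall j \<psi>'"
    and eq: "replicate i SStroke @ fm_string \<phi> @ xs = replicate j SStroke @ fm_string \<psi>' @ ys"
    by (cases \<psi>) (auto simp: var_string_def)
  from replicate_stroke_cancel[OF eq] have "i = j" and "fm_string \<phi> @ xs = fm_string \<psi>' @ ys"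
    by simp_all
  with Forall.IH[of xs \<psi>' ys] \<psi> show ?case by simp
qed

lemma inj_term_string: "inj term_string"
  using term_string_cancel[where xs = "[]" and ys = "[]"] by (auto intro: injI)

lemma inj_fm_string: "inj fm_string"
  using fm_string_cancel[where xs = "[]" and ys = "[]"] by (auto intro: injI)

end

theory Submission
  imports Defs "HOL-Number_Theory.Cong"
begin

text \<open>
  Tarski's diagonal argument. The string \<open>\<forall>v\<not>((v=S\<dots>S0)\<and>\<not>\<phi>)\<close> that applies \<open>\<phi>\<close> to the numeral of
  its own code \<open>g = \<alpha>(\<phi>)\<close> is a concatenation of fixed strings, \<open>\<phi>\<close> and the numeral of \<open>g\<close>, so its
  code is an arithmetical function of \<open>g\<close> as soon as \<open>n \<mapsto> \<alpha>(S\<dots>S0)\<close> is. The latter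
  arises by iterating the arithmetical map \<open>m \<mapsto> \<alpha>(S) \<circledast> m\<close>, which Goedel's \<open>\<beta>\<close>-function makes
  arithmetical; no computability of \<open>\<alpha>\<close> is involved.
\<close>

section \<open>Substitution\<close>

lemma finite_tvars [simp]: "finite (tvars t)"
  by (induction t) auto

lemma finite_fvars [simp]: "finite (fvars \<phi>)"
  by (induction \<phi>) auto

lemma tval_cong: "(\<And>i. i \<in> tvars t \<Longrightarrow> e i = e' i) \<Longrightarrow> tval e t = tval e' t"
  by (induction t) auto

lemma sat_cong: "(\<And>i. i \<in> fvars \<phi> \<Longrightarrow> e i = e' i) \<Longrightarrow> sat e \<phi> = sat e' \<phi>"
proof (induction \<phi> arbitrary: e e')
  case (Eq s t)
  then have "tval e s = tval e' s" "tval e t = tval e' t"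
    by (auto intro!: tval_cong)
  then show ?case by simp
next
  case (Neg \<phi>)
  have "sat e \<phi> = sat e' \<phi>" using Neg.prems by (intro Neg.IH) simp
  then show ?case by simp
next
  case (Conj \<phi> \<psi>)
  have "sat e \<phi> = sat e' \<phi>" "sat e \<psi> = sat e' \<psi>"
    using Conj.prems by (intro Conj.IH; simp)+
  then show ?case by simp
next
  case (Forall i \<phi>)
  have "sat (e(i := n)) \<phi> = sat (e'(i := n)) \<phi>" for n
    using Forall.prems by (intro Forall.IH) simp
  then show ?case by simp
qed

primrec tsubst :: "(nat \<Rightarrow> trm) \<Rightarrow> trm \<Rightarrow> trm" where
  "tsubst \<sigma> (Var i) = \<sigma> i"
| "tsubst \<sigma> Zero = Zero"
| "tsubst \<sigma> (Succ t) = Succ (tsubst \<sigma> t)"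
| "tsubst \<sigma> (Plus s t) = Plus (tsubst \<sigma> s) (tsubst \<sigma> t)"
| "tsubst \<sigma> (Times s t) = Times (tsubst \<sigma> s) (tsubst \<sigma> t)"

definition fresh :: "nat set \<Rightarrow> nat" where
  "fresh V = (SOME k. k \<notin> V)"

lemma fresh: "finite V \<Longrightarrow> fresh V \<notin> V"
  unfolding fresh_def by (rule someI_ex) (rule ex_new_if_finite[OF infinite_UNIV_nat])

text \<open>The bound variable is always renamed to one absent from every term put in for the
  remaining free variables, so nothing is captured.\<close>

primrec fsubst :: "(nat \<Rightarrow> trm) \<Rightarrow> fm \<Rightarrow> fm" where
  "fsubst \<sigma> (Eq s t) = Eq (tsubst \<sigma> s) (tsubst \<sigma> t)"
| "fsubst \<sigma> (Neg \<phi>) = Neg (fsubst \<sigma> \<phi>)"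
| "fsubst \<sigma> (Conj \<phi> \<psi>) = Conj (fsubst \<sigma> \<phi>) (fsubst \<sigma> \<psi>)"
| "fsubst \<sigma> (Forall i \<phi>) =
    (let k = fresh (\<Union>j\<in>fvars \<phi> - {i}. tvars (\<sigma> j)) in Forall k (fsubst (\<sigma>(i := Var k)) \<phi>))"

lemma tval_tsubst: "tval e (tsubst \<sigma> t) = tval (\<lambda>i. tval e (\<sigma> i)) t"
  by (induction t) auto

lemma sat_fsubst: "sat e (fsubst \<sigma> \<phi>) = sat (\<lambda>i. tval e (\<sigma> i)) \<phi>"
proof (induction \<phi> arbitrary: e \<sigma>)
  case (Forall i \<phi>)
  define k where "k = fresh (\<Union>j\<in>fvars \<phi> - {i}. tvars (\<sigma> j))"
  have k: "k \<notin> (\<Union>j\<in>fvars \<phi> - {i}. tvars (\<sigma> j))"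
    unfolding k_def by (rule fresh) simp
  \<comment> \<open>At \<open>i\<close> both environments give \<open>n\<close>; at any other free
    variable \<open>j\<close> of the body, \<open>k\<close> does not occur in
    \<open>\<sigma> j\<close>, so updating \<open>e\<close> at \<open>k\<close> goes
    unnoticed.\<close>
  have "sat (\<lambda>j. tval (e(k := n)) ((\<sigma>(i := Var k)) j)) \<phi> = sat ((\<lambda>j. tval e (\<sigma> j))(i := n)) \<phi>" for n
    using k by (intro sat_cong) (auto intro!: tval_cong)
  then show ?case by (simp add: Forall.IH Let_def del: fun_upd_apply flip: k_def)
qed (auto simp: tval_tsubst)

lemma tvars_tsubst: "tvars (tsubst \<sigma> t) = (\<Union>j\<in>tvars t. tvars (\<sigma> j))"
  by (induction t) auto

lemma fvars_fsubst: "fvars (fsubst \<sigma> \<phi>) \<subseteq> (\<Union>j\<in>fvars \<phi>. tvars (\<sigma> j))"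
proof (induction \<phi> arbitrary: \<sigma>)
  case (Forall i \<phi>)
  define k where "k = fresh (\<Union>j\<in>fvars \<phi> - {i}. tvars (\<sigma> j))"
  have "fvars (fsubst (\<sigma>(i := Var k)) \<phi>) \<subseteq> (\<Union>j\<in>fvars \<phi>. tvars ((\<sigma>(i := Var k)) j))"
    by (rule Forall.IH)
  also have "\<dots> \<subseteq> insert k (\<Union>j\<in>fvars \<phi> - {i}. tvars (\<sigma> j))"
    by (auto split: if_splits)
  finally show ?case unfolding fsubst.simps fvars.simps Let_def k_def[symmetric] by blast
next
  case (Conj \<phi> \<psi>)
  show ?case using Conj.IH[of \<sigma>] by auto
qed (auto simp: tvars_tsubst)

section \<open>Definable predicates\<close>

text \<open>Definability is phrased semantically, for functions and predicates of the environment,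
  so that closure rules follow the shape of a HOL expression and no formula has to be written
  out.\<close>

definition dterm :: "((nat \<Rightarrow> nat) \<Rightarrow> nat) \<Rightarrow> bool" where
  "dterm f \<longleftrightarrow> (\<exists>t. \<forall>e. tval e t = f e)"

definition dpred :: "((nat \<Rightarrow> nat) \<Rightarrow> bool) \<Rightarrow> bool" where
  "dpred P \<longleftrightarrow> (\<exists>\<phi>. \<forall>e. sat e \<phi> = P e)"

lemma dterm_var: "dterm (\<lambda>e. e i)"
  unfolding dterm_def by (metis tval.simps(1))

lemma dterm_Suc: "dterm f \<Longrightarrow> dterm (\<lambda>e. Suc (f e))"
  unfolding dterm_def by (metis tval.simps(3))

lemma dterm_const: "dterm (\<lambda>e. c)"
proof (induction c)
  case 0
  show ?case unfolding dterm_def by (metis tval.simps(2))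
qed (rule dterm_Suc)

lemma dterm_plus: "dterm f \<Longrightarrow> dterm g \<Longrightarrow> dterm (\<lambda>e. f e + g e)"
  unfolding dterm_def by (metis tval.simps(4))

lemma dterm_times: "dterm f \<Longrightarrow> dterm g \<Longrightarrow> dterm (\<lambda>e. f e * g e)"
  unfolding dterm_def by (metis tval.simps(5))

text \<open>Environments that list finitely many arguments are nested \<open>case_nat\<close>
  expressions; this rule checks them position by position for \<open>dpred_subst\<close>.\<close>

lemma dterm_case_nat:
  "dterm f \<Longrightarrow> (\<And>j. dterm (\<lambda>e. g e j)) \<Longrightarrow> dterm (\<lambda>e. case_nat (f e) (g e) i)"
  by (cases i) auto

lemma dpred_eq: "dterm f \<Longrightarrow> dterm g \<Longrightarrow> dpred (\<lambda>e. f e = g e)"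
  unfolding dterm_def dpred_def by (metis sat.simps(1))

lemma dpred_not: "dpred P \<Longrightarrow> dpred (\<lambda>e. \<not> P e)"
  unfolding dpred_def by (metis sat.simps(2))

lemma dpred_conj: "dpred P \<Longrightarrow> dpred Q \<Longrightarrow> dpred (\<lambda>e. P e \<and> Q e)"
  unfolding dpred_def by (metis sat.simps(3))

lemma dpred_imp: "dpred P \<Longrightarrow> dpred Q \<Longrightarrow> dpred (\<lambda>e. P e \<longrightarrow> Q e)"
  using dpred_not[OF dpred_conj[OF _ dpred_not, of P Q]] by simp

lemma dpred_subst: "dpred P \<Longrightarrow> (\<And>i. dterm (\<lambda>e. \<tau> e i)) \<Longrightarrow> dpred (\<lambda>e. P (\<tau> e))"
proof -
  assume "dpred P" and "\<And>i. dterm (\<lambda>e. \<tau> e i)"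
  then obtain \<phi> \<sigma> where "\<And>e. sat e \<phi> = P e" and "\<And>i e. tval e (\<sigma> i) = \<tau> e i"
    unfolding dpred_def dterm_def by metis
  then have "sat e (fsubst \<sigma> \<phi>) = P (\<tau> e)" for e
    by (simp add: sat_fsubst)
  then show ?thesis unfolding dpred_def by blast
qed

text \<open>
  Quantified variables are handled in de Bruijn style: the quantified number takes
  position 0 of the environment and the other positions move up by one.
\<close>

lemma dpred_all:
  assumes "dpred (\<lambda>e. P (\<lambda>i. e (Suc i)) (e 0))"
  shows "dpred (\<lambda>e. \<forall>n. P e n)"
proof -
  obtain \<phi> where \<phi>: "\<And>e. sat e \<phi> = P (\<lambda>i. e (Suc i)) (e 0)"
    using assms unfolding dpred_def by blast
  \<comment> \<open>The substitution below sends position 0 to \<open>Var k\<close> and position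
    \<open>Suc i\<close> to \<open>Var i\<close>. Quantifying over \<open>Var k\<close> can thus
    clash only with position \<open>Suc k\<close>, which must not be free in
    \<open>\<phi>\<close>.\<close>
  define k where "k = fresh {i. Suc i \<in> fvars \<phi>}"
  have "finite {i. Suc i \<in> fvars \<phi>}"
    using finite_vimageI[of "fvars \<phi>" Suc] by (simp add: vimage_def)
  then have k: "Suc k \<notin> fvars \<phi>"
    using fresh unfolding k_def by blast
  have "sat (e(k := n)) (fsubst (case_nat (Var k) Var) \<phi>) = P e n" for e n
  proof -
    have "sat (e(k := n)) (fsubst (case_nat (Var k) Var) \<phi>) = sat (case_nat n e) \<phi>"
      unfolding sat_fsubst using k by (intro sat_cong) (auto split: nat.split)
    then show ?thesis by (simp add: \<phi>)
  qed
  then have "sat e (Forall k (fsubst (case_nat (Var k) Var) \<phi>)) = (\<forall>n. P e n)" for e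
    by simp
  then show ?thesis unfolding dpred_def by blast
qed

lemma dpred_ex:
  assumes "dpred (\<lambda>e. P (\<lambda>i. e (Suc i)) (e 0))"
  shows "dpred (\<lambda>e. \<exists>n. P e n)"
  using dpred_not[OF dpred_all[of "\<lambda>e n. \<not> P e n", OF dpred_not[OF assms]]] by simp

lemma dpred_comp1:
  assumes "dpred (\<lambda>e. R (e 0))" "dterm f"
  shows "dpred (\<lambda>e. R (f e))"
  using dpred_subst[OF assms(1), where \<tau> = "\<lambda>e _. f e"] assms(2) by simp

text \<open>All positions after the first read \<open>g e\<close>; those from 2 on are mere
  filler.\<close>

lemma dpred_comp2:
  assumes "dpred (\<lambda>e. R (e 0) (e 1))" "dterm f" "dterm g"
  shows "dpred (\<lambda>e. R (f e) (g e))"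
proof -
  have "dterm (\<lambda>e. case_nat (f e) (\<lambda>_. g e) i)" for i
    by (intro dterm_case_nat assms)
  from dpred_subst[OF assms(1), of "\<lambda>e. case_nat (f e) (\<lambda>_. g e)", OF this] show ?thesis
    by simp
qed

lemma dpred_comp3:
  assumes "dpred (\<lambda>e. R (e 0) (e 1) (e 2))" "dterm f" "dterm g" "dterm h"
  shows "dpred (\<lambda>e. R (f e) (g e) (h e))"
proof -
  have "dterm (\<lambda>e. case_nat (f e) (case_nat (g e) (\<lambda>_. h e)) i)" for i
    by (intro dterm_case_nat assms)
  from dpred_subst[OF assms(1), of "\<lambda>e. case_nat (f e) (case_nat (g e) (\<lambda>_. h e))", OF this]
  show ?thesis by (simp add: numeral_2_eq_2)
qed

lemma dpred_less:
  assumes "dterm f" "dterm g"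
  shows "dpred (\<lambda>e. f e < g e)"
proof -
  have "dpred (\<lambda>e. \<exists>n. e 1 = Suc (e 0 + n))"
    by (intro dpred_ex dpred_eq dterm_Suc dterm_plus dterm_var)
  then have "dpred (\<lambda>e. e 0 < e 1)"
    by (simp only: less_iff_Suc_add)
  then show ?thesis
    using assms by (rule dpred_comp2)
qed

lemmas dpred_intros =
  dpred_ex dpred_all dpred_conj dpred_imp dpred_not dpred_eq dpred_less
  dterm_var dterm_Suc dterm_plus dterm_times dterm_const

text \<open>\<open>dpred\<close> does not bound the free variables of its witness. Putting
  \<open>Zero\<close> for every variable but \<open>Var 0\<close> removes the others, and truth is
  unchanged because it depends on \<open>e 0\<close> alone.\<close>

lemma dpred_unary_fm:
  assumes "dpred (\<lambda>e. R (e 0))"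
  obtains \<phi> where "fvars \<phi> \<subseteq> {0}" "\<And>e. sat e \<phi> = R (e 0)"
proof -
  obtain \<psi> where \<psi>: "\<And>e. sat e \<psi> = R (e 0)"
    using assms unfolding dpred_def by blast
  let ?\<sigma> = "\<lambda>i. if i = 0 then Var 0 else Zero"
  have "(\<Union>j\<in>fvars \<psi>. tvars (?\<sigma> j)) \<subseteq> {0}"
    by (auto split: if_splits)
  then have "fvars (fsubst ?\<sigma> \<psi>) \<subseteq> {0}"
    using fvars_fsubst by blast
  moreover have "sat e (fsubst ?\<sigma> \<psi>) = R (e 0)" for e
    by (simp add: sat_fsubst \<psi>)
  ultimately show thesis by (rule that)
qed

lemma arithmetical_imp_dpred: "arithmetical k R \<Longrightarrow> dpred (\<lambda>e. map e [0..<k] \<in> R)"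
  unfolding arithmetical_def dpred_def
  by (elim conjE exE, rule exI, rule allI, rule sym, erule spec)

section \<open>Definability by iteration\<close>

text \<open>The modulus is 1 + (i + 1) d; the shift from i to i + 1 keeps it from being 1 at index 0
  when d is positive.\<close>

definition beta :: "nat \<Rightarrow> nat \<Rightarrow> nat \<Rightarrow> nat" where
  "beta c d i = c mod Suc (Suc i * d)"

text \<open>The first modulus is coprime to \<open>d\<close>, hence to the divisor
  \<open>j - i\<close> of \<open>d\<close>, hence to (j - i) d, which is the difference of the two
  moduli.\<close>

lemma coprime_beta_moduli:
  assumes "i < j" "j - i dvd d"
  shows "coprime (Suc (Suc i * d)) (Suc (Suc j * d))"
proof -
  let ?m = "Suc (Suc i * d)"
  have d: "coprime ?m d"
  proof (rule coprimeI)
    fix c assume "c dvd ?m" "c dvd d"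
    then have "c dvd Suc i * d + 1" "c dvd Suc i * d" by auto
    then show "is_unit c" by (simp only: dvd_add_right_iff)
  qed
  with assms(2) have "coprime ?m (j - i)"
    by (meson coprime_divisors dvd_refl)
  with d have "coprime ?m ((j - i) * d)" by simp
  then have "coprime ?m (?m + (j - i) * d)"
    by (simp only: coprime_iff_gcd_eq_1 gcd_add2)
  moreover have "?m + (j - i) * d = Suc (Suc j * d)"
    using assms(1) by (simp add: algebra_simps flip: add_mult_distrib)
  ultimately show ?thesis by (simp only:)
qed

lemma beta_complete: "\<exists>c d. \<forall>i\<le>n. beta c d i = a i"
proof -
  \<comment> \<open>The summand \<open>n\<close> makes every difference of distinct indices divide
    \<open>fact M\<close>, so the moduli are pairwise coprime. The sum bounds each
    \<open>a i\<close> below its modulus, so the residue is \<open>a i\<close> itself.\<close>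
  define M where "M = n + (\<Sum>i\<le>n. a i)"
  define d where "d = (fact M :: nat)"
  let ?m = "\<lambda>i. Suc (Suc i * d)"
  have less: "coprime (?m i) (?m j)" if "i < j" "j \<le> n" for i j
    using that by (intro coprime_beta_moduli) (auto simp: d_def M_def intro!: dvd_fact)
  have "coprime (?m i) (?m j)" if "i \<le> n" "j \<le> n" "i \<noteq> j" for i j
    using less[of i j] less[of j i] that by (auto simp: coprime_commute neq_iff simp del: mult_Suc)
  then have "\<forall>i\<in>{..n}. \<forall>j\<in>{..n}. i \<noteq> j \<longrightarrow> coprime (?m i) (?m j)"
    by (simp del: mult_Suc)
  then obtain c where c: "\<forall>i\<in>{..n}. [c = a i] (mod ?m i)"
    using chinese_remainder_nat[of "{..n}" ?m a] by auto
  have "beta c d i = a i" if "i \<le> n" for i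
  proof -
    have "a i \<le> M"
      using that member_le_sum[of i "{..n}" a] by (simp add: M_def)
    also have "M \<le> d" by (simp add: d_def fact_ge_self)
    finally have "a i < ?m i" by simp
    with c that show ?thesis by (simp add: beta_def cong_def)
  qed
  then show ?thesis by blast
qed

lemma dpred_beta: "dpred (\<lambda>e. beta (e 0) (e 1) (e 2) = e 3)"
proof -
  \<comment> \<open>Division with remainder eliminates \<open>mod\<close> in favour of sums,
    products and an existential quantifier.\<close>
  have "beta c d i = y \<longleftrightarrow> y < Suc (Suc i * d) \<and> (\<exists>q. c = q * Suc (Suc i * d) + y)" for c d i y
    unfolding beta_def
    by (metis div_mult_mod_eq mod_less mod_less_divisor mod_mult_self3 zero_less_Suc)
  then show ?thesis by (simp only:) (intro dpred_intros)
qed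

lemma dpred_beta_comp:
  assumes "dterm f" "dterm g" "dterm h" "dterm k"
  shows "dpred (\<lambda>e. beta (f e) (g e) (h e) = k e)"
proof -
  have "dterm (\<lambda>e. case_nat (f e) (case_nat (g e) (case_nat (h e) (\<lambda>_. k e))) i)" for i
    by (intro dterm_case_nat assms)
  from dpred_subst[OF dpred_beta,
      of "\<lambda>e. case_nat (f e) (case_nat (g e) (case_nat (h e) (\<lambda>_. k e)))", OF this]
  show ?thesis by (simp add: numeral_2_eq_2 numeral_3_eq_3)
qed

text \<open>A computation of \<open>a n\<close> is a finite sequence coded by \<open>beta\<close>.
  \<open>R\<close> has to be the graph of the step only along the orbit, so partial operations such
  as concatenation of codes qualify.\<close>

lemma dpred_orbit:
  assumes "dpred (\<lambda>e. R (e 0) (e 1))" and step: "\<And>n y. R (a n) y \<longleftrightarrow> y = a (Suc n)"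
  shows "dpred (\<lambda>e. a (e 0) = e 1)"
proof -
  \<comment> \<open>The variables \<open>u\<close> and \<open>v\<close> name the values of
    \<open>beta\<close>, so that \<open>beta\<close> enters only through its definable
    graph.\<close>
  let ?Q = "\<lambda>n y. \<exists>c d. beta c d 0 = a 0 \<and> beta c d n = y \<and>
    (\<forall>i. i < n \<longrightarrow> (\<exists>u v. beta c d i = u \<and> beta c d (Suc i) = v \<and> R u v))"
  have "a n = y \<longleftrightarrow> ?Q n y" for n y
  proof
    assume "a n = y"
    moreover obtain c d where "\<forall>i\<le>n. beta c d i = a i"
      using beta_complete by blast
    ultimately show "?Q n y"
      using step by (intro exI[of _ c] exI[of _ d]) auto
  next
    assume "?Q n y"
    then obtain c d where 0: "beta c d 0 = a 0" and n: "beta c d n = y"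
      and R: "\<And>i. i < n \<Longrightarrow> R (beta c d i) (beta c d (Suc i))"
      by blast
    have "i \<le> n \<Longrightarrow> beta c d i = a i" for i
    proof (induction i)
      case (Suc i)
      with R[of i] step show ?case by simp
    qed (rule 0)
    with n show "a n = y" by simp
  qed
  then show ?thesis
    by (simp only:) (intro dpred_intros dpred_beta_comp dpred_comp2[OF assms(1)])
qed

section \<open>The diagonal argument\<close>

primrec numeral_trm :: "nat \<Rightarrow> trm" where
  "numeral_trm 0 = Zero"
| "numeral_trm (Suc n) = Succ (numeral_trm n)"

lemma tval_numeral_trm [simp]: "tval e (numeral_trm n) = n"
  by (induction n) auto

lemma tvars_numeral_trm [simp]: "tvars (numeral_trm n) = {}"
  by (induction n) auto

lemma term_string_nonempty [simp]: "term_string t \<in> Astar"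
  by (cases t) (auto simp: Astar_def var_string_def)

lemma fm_string_nonempty [simp]: "fm_string \<phi> \<in> Astar"
  by (cases \<phi>) (auto simp: Astar_def)

text \<open>This says that \<open>Var 0\<close> = n implies \<open>\<phi>\<close>. Unlike a
  substitution of the numeral, it leaves the string of \<open>\<phi>\<close> intact, so
  concatenation suffices to build it.\<close>

definition applied_to :: "fm \<Rightarrow> nat \<Rightarrow> fm" where
  "applied_to \<phi> n = Forall 0 (Neg (Conj (Eq (Var 0) (numeral_trm n)) (Neg \<phi>)))"

lemma sat_applied_to: "sat e (applied_to \<phi> n) = sat (e(0 := n)) \<phi>"
  by (simp add: applied_to_def)

lemma sentence_applied_to: "fvars \<phi> \<subseteq> {0} \<Longrightarrow> sentence (applied_to \<phi> n)"
  by (auto simp: applied_to_def sentence_def)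

lemma fm_string_applied_to:
  "fm_string (applied_to \<phi> n) = [SAll, SVar, SNot, SLparen, SLparen, SVar, SEq] @
    term_string (numeral_trm n) @ [SRparen, SAnd, SNot] @ fm_string \<phi> @ [SRparen]"
  by (simp add: applied_to_def var_string_def)

theorem mainTheorem5:
  fixes \<alpha> :: "symbol list \<Rightarrow> nat"
  assumes "arithmetical_simulation \<alpha>"
  shows "\<not> arithmetical 1 {[\<alpha> (fm_string \<phi>)] | \<phi>. sentence \<phi> \<and> true_in_N \<phi>}"
proof
  assume T: "arithmetical 1 {[\<alpha> (fm_string \<phi>)] | \<phi>. sentence \<phi> \<and> true_in_N \<phi>}"
  define tr where "tr x \<longleftrightarrow> (\<exists>\<phi>. x = \<alpha> (fm_string \<phi>) \<and> sentence \<phi> \<and> true_in_N \<phi>)" for x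
  \<comment> \<open>The membership conditions confine \<open>cc\<close> to the graph assumed
    arithmetical; outside the code set \<open>code_concat\<close> has arbitrary values.\<close>
  define cc where "cc m n p \<longleftrightarrow> p = code_concat \<alpha> m n \<and> m \<in> code_set \<alpha> \<and> n \<in> code_set \<alpha>" for m n p
  have inj: "inj_on \<alpha> Astar"
    using assms by (simp add: arithmetical_simulation_def numbering_def)
  have dtr: "dpred (\<lambda>e. tr (e 0))"
    using arithmetical_imp_dpred[OF T] by (simp add: tr_def)
  have "arithmetical 3 {[m, n, code_concat \<alpha> m n] | m n. m \<in> code_set \<alpha> \<and> n \<in> code_set \<alpha>}"
    using assms by (simp add: arithmetical_simulation_def)
  note arithmetical_imp_dpred[OF this]
  moreover have "map e [0..<3] = [e 0, e 1, e 2]" for e :: "nat \<Rightarrow> nat"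
    by (simp add: upt_rec numeral_2_eq_2)
  ultimately have dcc: "dpred (\<lambda>e. cc (e 0) (e 1) (e 2))"
    by (simp add: cc_def)
  have cc: "cc (\<alpha> u) (\<alpha> v) p \<longleftrightarrow> p = \<alpha> (u @ v)" if "u \<in> Astar" "v \<in> Astar" for u v p
    using that inj by (simp add: cc_def code_set_def code_concat_def)

  define nm where "nm n = \<alpha> (term_string (numeral_trm n))" for n
  have dnm: "dpred (\<lambda>e. nm (e 0) = e 1)"
  proof (rule dpred_orbit)
    show "dpred (\<lambda>e. cc (\<alpha> [SSucc]) (e 0) (e 1))"
      by (intro dpred_comp3[OF dcc] dpred_intros)
    show "cc (\<alpha> [SSucc]) (nm n) y \<longleftrightarrow> y = nm (Suc n)" for n y
      unfolding nm_def by (subst cc) (simp_all, simp add: Astar_def)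
  qed
  let ?a = "[SAll, SVar, SNot, SLparen, SLparen, SVar, SEq]"
  let ?b = "[SRparen, SAnd, SNot]"
  \<comment> \<open>The string is assembled from the right: for x the code of a formula,
    \<open>p\<close>, \<open>q\<close>, \<open>r\<close> and \<open>s\<close> code ever longer tails
    of that formula applied to x, and \<open>s\<close> codes the whole. If x is no code, no
    \<open>p\<close> exists and \<open>D x\<close> holds.\<close>
  define D where "D x \<longleftrightarrow> \<not> (\<exists>n p q r s. nm x = n \<and> cc x (\<alpha> [SRparen]) p \<and> cc (\<alpha> ?b) p q \<and>
    cc n q r \<and> cc (\<alpha> ?a) r s \<and> tr s)" for x
  have "dpred (\<lambda>e. D (e 0))"
    unfolding D_def
    by (intro dpred_intros dpred_comp3[OF dcc] dpred_comp2[OF dnm] dpred_comp1[OF dtr])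
  then obtain \<phi> where \<phi>: "fvars \<phi> \<subseteq> {0}" "\<And>e. sat e \<phi> = D (e 0)"
    by (rule dpred_unary_fm) blast
  define g where "g = \<alpha> (fm_string \<phi>)"
  define \<delta> where "\<delta> = applied_to \<phi> g"
  have Astar_intros: "c # v \<in> Astar" "u \<in> Astar \<Longrightarrow> u @ v \<in> Astar" for c u v
    by (simp_all add: Astar_def)
  \<comment> \<open>On codes \<open>cc\<close> is functional, so each existential quantifier has a
    forced witness. Keeping \<open>append_Cons\<close> out preserves the blocks displayed in
    \<open>fm_string_applied_to\<close>.\<close>
  have "D g \<longleftrightarrow> \<not> tr (\<alpha> (fm_string \<delta>))"
    unfolding D_def \<delta>_def fm_string_applied_to
    by (simp add: nm_def g_def cc Astar_intros del: append_Cons)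
  \<comment> \<open>Injectivity of \<open>\<alpha>\<close> on \<open>Astar\<close> and of
    \<open>fm_string\<close> makes \<open>\<delta>\<close> the only formula with this code.\<close>
  moreover have "tr (\<alpha> (fm_string \<delta>)) \<longleftrightarrow> true_in_N \<delta>"
    using inj_onD[OF inj] inj_fm_string sentence_applied_to[OF \<phi>(1)]
    unfolding tr_def \<delta>_def by (metis fm_string_nonempty injD)
  moreover have "true_in_N \<delta> \<longleftrightarrow> D g"
    by (simp add: true_in_N_def \<delta>_def sat_applied_to \<phi>(2))
  ultimately show False by blast
qed

end
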